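(* Let $K$ be an ergodic Markov chain on a finite set $X$ that is reversible with respect to a probability distribution $\pi$ on $X$ with $\pi(x)>0$ for all $x\in X$. Let $1,\lambda_1,\dots,\lambda_d$ be the distinct eigenvalues of $K$ (so $d+1\le |X|$). Suppose that $x,y$ are elements of $X$ with $\mathrm{dist}(x,y)=d$. Then for all integers $r\ge 0$, $$ 1-\frac{K^r(x,y)}{\pi(y)} = \sum_{i=1}^d \lambda_i^r \left[\prod_{\substack{1\le j\le d\\ j\ne i}} \frac{1-\lambda_j}{\lambda_i-\lambda_j}\right].$$
   Context: $K$ is identified with its transition matrix $(K(x,y))_{x,y\in X}$ (nonnegative entries, rows summing to 1), and $K^r(x,y)$ is the $(x,y)$ entry of its $r$-th power. Reversible with respect to $\pi$ means $\pi(x)K(x,y)=\pi(y)K(y,x)$ for all $x,y$. Then $K$ acts as a self-adjoint operator on $L^2(\pi)$, with real eigenvalues (listed with multiplicity) $-1\le\beta_{|X|-1}\le\dots\le\beta_1\le\beta_0=1$; $K$ is called ergodic if $|\beta_1|<1$ and $|\beta_{|X|-1}|<1$. The distance $\mathrm{dist}(x,y)$ is the smallest $r\ge 0$ such that $K^r(x,y)>0$. The convention $0^0=1$ is used. *)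

theory Defs
  imports "HOL-Analysis.Analysis" "HOL-Probability.Probability_Mass_Function"
begin

definition transition_matrix :: "real^'a^'a \<Rightarrow> bool" where
  "transition_matrix K \<longleftrightarrow> (\<forall>x y. 0 \<le> K $ x $ y) \<and> (\<forall>x. (\<Sum>y\<in>UNIV. K $ x $ y) = 1)"

primrec matrix_power :: "real^'a^'a \<Rightarrow> nat \<Rightarrow> real^'a^'a" where
  "matrix_power K 0 = mat 1"
| "matrix_power K (Suc r) = K ** matrix_power K r"

definition reversible :: "real^'a^'a \<Rightarrow> 'a pmf \<Rightarrow> bool" where
  "reversible K \<pi> \<longleftrightarrow> (\<forall>x y. pmf \<pi> x * K $ x $ y = pmf \<pi> y * K $ y $ x)"

text \<open>The operator on \<open>L\<^sup>2(\<pi>)\<close> given by \<open>K\<close> sends \<open>f\<close> to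
  \<open>x \<mapsto> (\<Sum>y\<in>UNIV. K(x,y) f(y))\<close>, that is, to \<open>K *v f\<close>.\<close>

definition eigenspace :: "real^'a^'a \<Rightarrow> real \<Rightarrow> (real^'a) set" where
  "eigenspace K l = {f. K *v f = l *\<^sub>R f}"

definition eigenvalues :: "real^'a^'a \<Rightarrow> real set" where
  "eigenvalues K = {l. \<exists>f. f \<noteq> 0 \<and> K *v f = l *\<^sub>R f}"

text \<open>Eigenvalues in descending order, each repeated according to the dimension of its
  eigenspace. For the self-adjoint operators considered here (\<open>K\<close> reversible with respect to a
  positive \<open>\<pi>\<close>) geometric and algebraic multiplicities agree, and the list has \<open>CARD('a)\<close> entries.\<close>

definition eigenvalue_list :: "real^'a^'a \<Rightarrow> real list" where
  "eigenvalue_list K =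
     concat (map (\<lambda>l. replicate (dim (eigenspace K l)) l) (rev (sorted_list_of_set (eigenvalues K))))"

definition beta :: "real^'a^'a \<Rightarrow> nat \<Rightarrow> real" where
  "beta K i = eigenvalue_list K ! i"

text \<open>On a one-point state space \<open>\<beta>\<^sub>0 = 1\<close> is the only eigenvalue and there is no \<open>\<beta>\<^sub>1\<close>;
  the condition is then taken to be vacuous.\<close>

definition ergodic :: "real^'a^'a \<Rightarrow> bool" where
  "ergodic K \<longleftrightarrow>
     (CARD('a) \<ge> 2 \<longrightarrow> \<bar>beta K 1\<bar> < 1 \<and> \<bar>beta K (CARD('a) - 1)\<bar> < 1)"

text \<open>Least number of steps leading from \<open>x\<close> to \<open>y\<close> with positive probability. It exists for
  ergodic reversible chains, as these are irreducible; the value \<open>\<infinity>\<close> covers unreachable \<open>y\<close>.\<close>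

definition chain_dist :: "real^'a^'a \<Rightarrow> 'a \<Rightarrow> 'a \<Rightarrow> enat" where
  "chain_dist K x y = Inf {enat r |r. matrix_power K r $ x $ y > 0}"

end

theory Submission
  imports Defs
begin

text \<open>
  Reversibility makes \<open>K\<close> self-adjoint for the inner product weighted by \<open>\<pi>\<close>, so the indicator
  function of \<open>y\<close> is a sum of eigenfunctions \<open>c\<^sub>l\<close>, one for each eigenvalue \<open>l\<close>. Applying \<open>K\<^sup>r\<close> and
  evaluating at \<open>x\<close> shows that \<open>K\<^sup>r(x,y)\<close> is the sum of the terms \<open>l\<^sup>r c\<^sub>l(x)\<close>. Ergodicity forces
  the eigenfunctions for \<open>1\<close> to be constant, and integrating against \<open>\<pi>\<close>, which annihilates
  every other eigenspace, identifies \<open>c\<^sub>1\<close> as \<open>\<pi>(y)\<close>. Hence \<open>K\<^sup>r(x,y) / \<pi>(y)\<close> equals \<open>1\<close> plus a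
  combination of the \<open>d\<close> exponentials \<open>\<lambda>\<^sub>i\<^sup>r\<close> (lemma \<open>spectral_expansion\<close>).

  Only the \<open>d\<close> coefficients of this combination depend on the chain beyond its eigenvalues, and
  \<open>K\<^sup>r(x,y) = 0\<close> for \<open>r < d\<close> gives \<open>d\<close> linear equations for them, a Vandermonde system. Lemma
  \<open>exponential_sum_coefficient\<close> solves it by combining the equations according to the polynomial
  of degree \<open>d - 1\<close> that vanishes at all \<open>\<lambda>\<^sub>j\<close> with \<open>j \<noteq> i\<close>.
\<close>

section \<open>Spectral theorem for symmetric maps\<close>

text \<open>
  This is the first-order condition at a minimum: a quadratic in \<open>t\<close> that vanishes at \<open>0\<close> and is
  never negative has derivative \<open>0\<close> there.
\<close>

lemma nonneg_quadratic_imp_linear_coeff_zero: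
  fixes a b :: real
  assumes "\<And>t. 0 \<le> 2 * t * a + t\<^sup>2 * b"
  shows "a = 0"
proof (rule ccontr)
  assume "a \<noteq> 0"
  define b' where "b' = \<bar>b\<bar> + 1"
  have b': "b' > 0" "b < b'" by (auto simp: b'_def)
  \<comment> \<open>The point \<open>t = - a / b\<close> would be the minimum if \<open>b > 0\<close>; the larger positive number \<open>b'\<close> in its
    place covers every sign of \<open>b\<close>.\<close>
  have "0 \<le> 2 * (- a / b') * a + (- a / b')\<^sup>2 * b" using assms .
  also have "\<dots> \<le> 2 * (- a / b') * a + (- a / b')\<^sup>2 * b'"
    using b' by (intro add_left_mono mult_left_mono) auto
  also have "\<dots> = - (a\<^sup>2 / b')"
    using b' by (simp add: power2_eq_square field_simps)
  also have "\<dots> < 0" using b' \<open>a \<noteq> 0\<close> by simp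
  finally show False by simp
qed

text \<open>
  The Rayleigh quotient \<open>v \<bullet> T v / (v \<bullet> v)\<close> attains its maximum on \<open>S\<close>, because the unit sphere of
  \<open>S\<close> is compact, and a maximizer is an eigenvector for the maximal value.
\<close>

lemma symmetric_eigenvector_exists:
  fixes T :: "'b::euclidean_space \<Rightarrow> 'b"
  assumes lin: "linear T" and sym: "\<And>u v. u \<bullet> T v = T u \<bullet> v"
    and S: "subspace S" and inv: "\<And>v. v \<in> S \<Longrightarrow> T v \<in> S"
    and w: "w \<in> S" "w \<noteq> 0"
  obtains f m where "f \<in> S" "f \<noteq> 0" "T f = m *\<^sub>R f"
proof -
  let ?C = "S \<inter> sphere 0 1"
  have "compact ?C"
    using closed_subspace[OF S] by (metis compact_Int_closed compact_sphere inf_commute)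
  moreover have "w /\<^sub>R norm w \<in> ?C"
    using w by (auto intro: subspace_scale[OF S])
  hence "?C \<noteq> {}" by blast
  moreover have "continuous_on ?C (\<lambda>v. v \<bullet> T v)"
    using linear_continuous_on[of T] lin
    by (intro continuous_on_inner continuous_on_id) (simp add: linear_conv_bounded_linear)
  ultimately obtain f where f: "f \<in> ?C" and fmax: "\<And>v. v \<in> ?C \<Longrightarrow> v \<bullet> T v \<le> f \<bullet> T f"
    using continuous_attains_sup[of ?C "\<lambda>v. v \<bullet> T v"] by blast
  define m where "m = f \<bullet> T f"
  have fS: "f \<in> S" and ff: "f \<bullet> f = 1" using f by (auto simp: norm_eq_1)
  have bound: "v \<bullet> T v \<le> m * (v \<bullet> v)" if "v \<in> S" for v
  proof (cases "v = 0")
    case False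
    have "v /\<^sub>R norm v \<in> ?C" using that False by (auto intro: subspace_scale[OF S])
    hence "(v /\<^sub>R norm v) \<bullet> T (v /\<^sub>R norm v) \<le> m" unfolding m_def by (rule fmax)
    hence "(v \<bullet> T v) / (norm v)\<^sup>2 \<le> m"
      using lin by (simp add: linear_cmul power2_eq_square field_simps)
    thus ?thesis using False by (simp add: divide_le_eq power2_norm_eq_inner)
  qed (use lin in \<open>simp add: linear_0\<close>)
  define h where "h = m *\<^sub>R f - T f"
  have hS: "h \<in> S" unfolding h_def using S fS inv by (intro subspace_diff subspace_scale) auto
  \<comment> \<open>The form \<open>v \<mapsto> m (v \<bullet> v) - v \<bullet> T v\<close> is nonnegative on \<open>S\<close> and vanishes at \<open>f\<close>, so
    along the line \<open>f + t h\<close> its first-order term, which is \<open>2 t (h \<bullet> h)\<close>, has to vanish.\<close>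
  have "0 \<le> 2 * t * (h \<bullet> h) + t\<^sup>2 * (m * (h \<bullet> h) - h \<bullet> T h)" for t
  proof -
    have "f + t *\<^sub>R h \<in> S" using S fS hS by (intro subspace_add subspace_scale)
    from bound[OF this]
    have "0 \<le> m * ((f + t *\<^sub>R h) \<bullet> (f + t *\<^sub>R h)) - (f + t *\<^sub>R h) \<bullet> T (f + t *\<^sub>R h)"
      by simp
    also have "\<dots> = 2 * t * (m * (h \<bullet> f) - h \<bullet> T f) + t\<^sup>2 * (m * (h \<bullet> h) - h \<bullet> T h)"
      using sym[of f h] ff
      by (simp add: linear_add[OF lin] linear_cmul[OF lin] m_def inner_commute
            algebra_simps power2_eq_square)
    also have "m * (h \<bullet> f) - h \<bullet> T f = h \<bullet> h"
      by (simp add: h_def inner_diff_right inner_diff_left)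
    finally show ?thesis .
  qed
  hence "h \<bullet> h = 0" by (rule nonneg_quadratic_imp_linear_coeff_zero)
  hence "T f = m *\<^sub>R f" by (simp add: h_def)
  moreover have "f \<noteq> 0" using ff by auto
  ultimately show ?thesis using fS that by blast
qed

text \<open>
  The orthogonal complement of the eigenvectors is invariant under a symmetric map. Were it
  nonzero, it would contain an eigenvector, which would be orthogonal to itself.
\<close>

theorem symmetric_eigenvectors_span:
  fixes T :: "'b::euclidean_space \<Rightarrow> 'b"
  assumes lin: "linear T" and sym: "\<And>u v. u \<bullet> T v = T u \<bullet> v"
  shows "span {f. \<exists>l. T f = l *\<^sub>R f} = UNIV"
proof (rule ccontr)
  let ?E = "{f. \<exists>l. T f = l *\<^sub>R f}"
  let ?P = "{v. \<forall>e\<in>?E. orthogonal e v}"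
  assume "span ?E \<noteq> UNIV"
  hence "span ?E \<subset> span UNIV" by auto
  then obtain w where "w \<noteq> 0" and "\<And>e. e \<in> span ?E \<Longrightarrow> orthogonal w e"
    by (rule orthogonal_to_subspace_exists_gen) blast
  hence w: "w \<in> ?P" "w \<noteq> 0"
    using span_base[of _ ?E] by (auto simp: orthogonal_commute)
  have inv: "T v \<in> ?P" if "v \<in> ?P" for v
    using that by (force simp: orthogonal_def sym)
  obtain f m where f: "f \<in> ?P" "f \<noteq> 0" "T f = m *\<^sub>R f"
    by (rule symmetric_eigenvector_exists[where T = T and S = ?P,
          OF lin sym subspace_orthogonal_to_vectors inv w])
  hence "orthogonal f f" by blast
  with f show False by (simp add: orthogonal_self)
qed

section \<open>Reversible chains\<close>

text \<open>
  Conjugating \<open>K\<close> by the diagonal matrix with entries \<open>sqrt (\<pi> z)\<close> turns self-adjointness for the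
  weighted inner product into symmetry for the standard one, and carries eigenvectors to
  eigenvectors.
\<close>

theorem reversible_eigenvectors_span:
  fixes K :: "real^'a^'a"
  assumes rev: "reversible K \<pi>" and pos: "\<And>z. pmf \<pi> z > 0"
  shows "span {f. \<exists>l. K *v f = l *\<^sub>R f} = UNIV"
proof -
  define s where "s z = sqrt (pmf \<pi> z)" for z
  have s: "s z > 0" "s z * s z = pmf \<pi> z" for z using pos[of z] by (auto simp: s_def)
  define D :: "real^'a \<Rightarrow> real^'a" where "D g = (\<chi> z. s z * g $ z)" for g
  define D' :: "real^'a \<Rightarrow> real^'a" where "D' g = (\<chi> z. g $ z / s z)" for g
  have DD: "D (D' g) = g" "D' (D g) = g" for g
    using s(1) by (auto simp: D_def D'_def vec_eq_iff less_imp_neq[THEN not_sym])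
  have linD: "linear D" "linear D'"
    by (auto intro!: linearI simp: D_def D'_def vec_eq_iff algebra_simps add_divide_distrib)
  define T where "T = (\<lambda>g. D (K *v D' g))"
  have linT: "linear T"
    using linear_compose[OF linear_compose[OF linD(2) matrix_vector_mul_linear[of K]] linD(1)]
    by (simp add: T_def o_def)
  have symT: "u \<bullet> T v = T u \<bullet> v" for u v
  proof -
    have K: "s i * K $ i $ j / s j = s j * K $ j $ i / s i" for i j
      using rev s[of i] s[of j] unfolding reversible_def
      by (simp add: field_simps) (metis mult.assoc mult.commute)
    have "u \<bullet> T v = (\<Sum>i\<in>UNIV. \<Sum>j\<in>UNIV. u $ i * (s i * K $ i $ j / s j) * v $ j)"
      by (simp add: T_def D_def D'_def inner_vec_def matrix_vector_mult_def sum_distrib_left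
           mult_ac)
    also have "\<dots> = (\<Sum>i\<in>UNIV. \<Sum>j\<in>UNIV. u $ i * (s j * K $ j $ i / s i) * v $ j)"
      by (simp only: K)
    also have "\<dots> = (\<Sum>j\<in>UNIV. \<Sum>i\<in>UNIV. u $ i * (s j * K $ j $ i / s i) * v $ j)"
      by (rule sum.swap)
    also have "\<dots> = T u \<bullet> v"
      by (simp add: T_def D_def D'_def inner_vec_def matrix_vector_mult_def sum_distrib_left
            sum_distrib_right mult_ac)
    finally show ?thesis .
  qed
  let ?E = "{f. \<exists>l. K *v f = l *\<^sub>R f}"
  have "D' ` {g. \<exists>l. T g = l *\<^sub>R g} \<subseteq> ?E"
  proof safe
    fix g l assume "T g = l *\<^sub>R g"
    hence "D' (T g) = l *\<^sub>R D' g" by (simp add: linear_cmul[OF linD(2)])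
    thus "\<exists>l. K *v D' g = l *\<^sub>R D' g" by (auto simp: T_def DD)
  qed
  hence "span (D' ` {g. \<exists>l. T g = l *\<^sub>R g}) \<subseteq> span ?E" by (rule span_mono)
  hence "range D' \<subseteq> span ?E"
    by (simp add: linear_span_image[OF linD(2)] symmetric_eigenvectors_span[OF linT symT])
  moreover have "range D' = UNIV" using DD(2) by (rule surjI)
  ultimately show ?thesis by blast
qed

text \<open>
  Sums of eigenspaces are subspaces, so eigenvectors with a common eigenvalue can be gathered
  into one term. The function \<open>c\<close> is defined on all reals; outside the spectrum its eigenvector
  equation forces it to be \<open>0\<close>.
\<close>

lemma eigenvector_decomposition:
  fixes K :: "real^'a^'a"
  assumes fin: "finite (eigenvalues K)" and v: "v \<in> span {f. \<exists>l. K *v f = l *\<^sub>R f}"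
  obtains c where "\<And>l. K *v c l = l *\<^sub>R c l" "v = (\<Sum>l\<in>eigenvalues K. c l)"
proof -
  let ?Q = "\<lambda>v. \<exists>c. (\<forall>l. K *v c l = l *\<^sub>R c l) \<and> v = (\<Sum>l\<in>eigenvalues K. c l)"
  have "subspace {v. ?Q v}"
  proof (rule subspaceI; clarify)
    show "?Q 0" by (rule exI[of _ "\<lambda>_. 0"]) simp
  next
    fix c c' :: "real \<Rightarrow> real^'a"
    assume "\<forall>l. K *v c l = l *\<^sub>R c l" "\<forall>l. K *v c' l = l *\<^sub>R c' l"
    thus "?Q ((\<Sum>l\<in>eigenvalues K. c l) + (\<Sum>l\<in>eigenvalues K. c' l))"
      by (intro exI[of _ "\<lambda>l. c l + c' l"])
         (simp add: sum.distrib matrix_vector_right_distrib scaleR_add_right)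
  next
    fix k and c :: "real \<Rightarrow> real^'a"
    assume "\<forall>l. K *v c l = l *\<^sub>R c l"
    thus "?Q (k *\<^sub>R (\<Sum>l\<in>eigenvalues K. c l))"
      by (intro exI[of _ "\<lambda>l. k *\<^sub>R c l"])
         (simp add: scaleR_sum_right matrix_vector_mult_scaleR mult.commute)
  qed
  moreover have "?Q f" if "K *v f = l *\<^sub>R f" for f l
  proof (intro exI[of _ "\<lambda>l'. if l' = l then f else 0"] conjI allI)
    show "K *v (if l' = l then f else 0) = l' *\<^sub>R (if l' = l then f else 0)" for l'
      using that by simp
    show "f = (\<Sum>l'\<in>eigenvalues K. if l' = l then f else 0)"
      using fin that by (auto simp: eigenvalues_def)
  qed
  ultimately have "?Q v" using span_induct[OF v, of ?Q] by blast
  thus ?thesis using that by blast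
qed

lemma matrix_power_eigenvector:
  "K *v f = l *\<^sub>R f \<Longrightarrow> matrix_power K r *v f = l ^ r *\<^sub>R f"
  by (induction r)
     (simp_all add: matrix_vector_mul_assoc[symmetric] matrix_vector_mult_scaleR mult.commute)

lemma matrix_power_nonneg:
  assumes "transition_matrix K"
  shows "0 \<le> matrix_power K r $ x $ y"
  using assms
  by (induction r arbitrary: x)
     (auto simp: mat_def matrix_matrix_mult_def transition_matrix_def intro!: sum_nonneg)

lemma matrix_power_eq_0_if_less_chain_dist:
  assumes "transition_matrix K" "enat r < chain_dist K x y"
  shows "matrix_power K r $ x $ y = 0"
proof (rule ccontr)
  assume "matrix_power K r $ x $ y \<noteq> 0"
  hence "matrix_power K r $ x $ y > 0"
    using matrix_power_nonneg[OF assms(1), of r x y] by simp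
  hence "chain_dist K x y \<le> enat r" unfolding chain_dist_def by (intro Inf_lower) auto
  with assms(2) show False by simp
qed

lemma constant_eigenvector:
  assumes "transition_matrix K"
  shows "K *v (\<chi> z. k) = (\<chi> z. k)"
  using assms
  by (simp add: transition_matrix_def matrix_vector_mult_def vec_eq_iff sum_distrib_right[symmetric])

lemma one_in_eigenvalues:
  fixes K :: "real^'a^'a"
  assumes "transition_matrix K"
  shows "1 \<in> eigenvalues K"
proof -
  have "(\<chi> z. 1) \<noteq> (0 :: real^'a)" by (simp add: vec_eq_iff)
  thus ?thesis
    unfolding eigenvalues_def using constant_eigenvector[OF assms, of 1]
    by (intro CollectI exI[of _ "\<chi> z. 1"]) simp
qed

text \<open>
  Maximum principle: at a point where \<open>\<bar>f\<bar>\<close> is maximal, the averaging operator \<open>K\<close> cannot increase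
  it.
\<close>

lemma eigenvalue_le_1:
  assumes K: "transition_matrix K" and l: "l \<in> eigenvalues K"
  shows "l \<le> 1"
proof -
  obtain f where f: "f \<noteq> 0" "K *v f = l *\<^sub>R f" using l by (auto simp: eigenvalues_def)
  have "Max (range (\<lambda>z. \<bar>f $ z\<bar>)) \<in> range (\<lambda>z. \<bar>f $ z\<bar>)" by (intro Max_in) auto
  then obtain z where z: "\<bar>f $ z\<bar> = Max (range (\<lambda>z. \<bar>f $ z\<bar>))" by (metis rangeE)
  have max: "\<bar>f $ y\<bar> \<le> \<bar>f $ z\<bar>" for y unfolding z by (intro Max_ge) auto
  have "f $ z \<noteq> 0"
    using f(1) max by (metis abs_0_eq abs_le_zero_iff vec_eq_iff zero_index)
  have "l * \<bar>f $ z\<bar> \<le> \<bar>(K *v f) $ z\<bar>"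
    by (simp add: f abs_mult mult_right_mono)
  also have "\<dots> \<le> (\<Sum>y\<in>UNIV. \<bar>K $ z $ y * f $ y\<bar>)"
    unfolding matrix_vector_mult_def by (simp add: sum_abs)
  also have "\<dots> \<le> (\<Sum>y\<in>UNIV. K $ z $ y * \<bar>f $ z\<bar>)"
    using K max by (intro sum_mono) (auto simp: transition_matrix_def abs_mult mult_left_mono)
  also have "\<dots> = \<bar>f $ z\<bar>"
    using K by (simp add: transition_matrix_def sum_distrib_right[symmetric])
  finally show ?thesis using \<open>f $ z \<noteq> 0\<close> by simp
qed

text \<open>
  Since \<open>1\<close> is the largest eigenvalue, its copies come first in the descending list of eigenvalues.
  Two copies would give \<open>\<beta>\<^sub>1 = 1\<close>, contradicting ergodicity.
\<close>

lemma ergodic_dim_eigenspace_1: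
  fixes K :: "real^'a^'a"
  assumes K: "transition_matrix K" and erg: "ergodic K" and fin: "finite (eigenvalues K)"
  shows "dim (eigenspace K 1) \<le> 1"
proof (rule ccontr)
  assume "\<not> ?thesis"
  then obtain n where n: "dim (eigenspace K 1) = Suc (Suc n)"
    by (metis One_nat_def not_less_eq_eq not0_implies_Suc le0)
  have "dim (eigenspace K 1) \<le> CARD('a)" using dim_subset_UNIV[of "eigenspace K 1"] by simp
  hence "CARD('a) \<ge> 2" using n by simp
  hence b: "\<bar>beta K 1\<bar> < 1" using erg by (simp add: ergodic_def)
  have 1: "1 \<in> eigenvalues K" using K by (rule one_in_eigenvalues)
  define xs where "xs = rev (sorted_list_of_set (eigenvalues K))"
  have set_xs: "set xs = eigenvalues K" using fin by (simp add: xs_def)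
  obtain l ls where xs: "xs = l # ls" using 1 set_xs by (cases xs) auto
  have "sorted_wrt (\<ge>) xs" unfolding xs_def by (simp add: sorted_wrt_rev)
  hence "1 \<le> l" using 1 set_xs xs by auto
  moreover have "l \<le> 1" using eigenvalue_le_1[OF K] set_xs xs by auto
  ultimately have "l = 1" by simp
  hence "eigenvalue_list K = 1 # 1 # replicate n 1
      @ concat (map (\<lambda>l. replicate (dim (eigenspace K l)) l) ls)"
    using n by (simp add: eigenvalue_list_def xs_def[symmetric] xs)
  with b show False by (simp add: beta_def)
qed

lemma ergodic_harmonic_constant:
  fixes K :: "real^'a^'a"
  assumes K: "transition_matrix K" and "ergodic K" "finite (eigenvalues K)" and f: "K *v f = f"
  shows "f $ x = f $ y"
proof (rule ccontr)
  assume ne: "f $ x \<noteq> f $ y"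
  let ?one = "\<chi> z. 1 :: real^'a"
  have "f \<notin> span {?one}" using ne by (auto simp: span_singleton)
  hence ind: "independent {f, ?one}"
    by (auto simp: independent_insert vec_eq_iff)
  have "f \<noteq> ?one" using \<open>f \<notin> span {?one}\<close> span_base by blast
  hence "card {f, ?one} = 2" by simp
  moreover have "{f, ?one} \<subseteq> eigenspace K 1"
    using f constant_eigenvector[OF K, of 1] by (simp add: eigenspace_def)
  hence "card {f, ?one} \<le> dim (eigenspace K 1)" using ind by (rule independent_card_le_dim)
  ultimately show False using ergodic_dim_eigenspace_1[OF assms(1-3)] by simp
qed

text \<open>
  Summing the detailed balance equations shows that \<open>\<pi>\<close> is invariant under \<open>K\<close>, so applying \<open>K\<close>
  does not change means. For an eigenfunction with eigenvalue other than \<open>1\<close> this forces mean \<open>0\<close>.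
\<close>

lemma stationary:
  fixes K :: "real^'a^'a"
  assumes K: "transition_matrix K" and rev: "reversible K \<pi>"
  shows "(\<Sum>z\<in>UNIV. pmf \<pi> z * (K *v f) $ z) = (\<Sum>z\<in>UNIV. pmf \<pi> z * f $ z)"
proof -
  have "(\<Sum>z\<in>UNIV. pmf \<pi> z * (K *v f) $ z) = (\<Sum>z\<in>UNIV. \<Sum>w\<in>UNIV. pmf \<pi> z * K $ z $ w * f $ w)"
    by (simp add: matrix_vector_mult_def sum_distrib_left mult.assoc)
  also have "\<dots> = (\<Sum>z\<in>UNIV. \<Sum>w\<in>UNIV. K $ w $ z * (pmf \<pi> w * f $ w))"
    using rev by (simp add: reversible_def mult_ac)
  also have "\<dots> = (\<Sum>w\<in>UNIV. (\<Sum>z\<in>UNIV. K $ w $ z) * (pmf \<pi> w * f $ w))"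
    by (subst sum.swap) (simp add: sum_distrib_right)
  finally show ?thesis using K by (simp add: transition_matrix_def)
qed

text \<open>
  This is the spectral decomposition of \<open>K\<^sup>r\<close> applied to the indicator function of \<open>y\<close>, read off at
  \<open>x\<close>. The leading \<open>1\<close> is the contribution of the eigenvalue \<open>1\<close>: its component is a constant, and
  since the other components have mean \<open>0\<close>, that constant is the mean \<open>\<pi>(y)\<close> of the indicator.
\<close>

lemma spectral_expansion:
  fixes K :: "real^'a^'a"
  assumes K: "transition_matrix K" and erg: "ergodic K" and rev: "reversible K \<pi>"
    and pos: "\<And>z. pmf \<pi> z > 0" and fin: "finite (eigenvalues K)"
  obtains a where "\<And>r. matrix_power K r $ x $ y / pmf \<pi> y = 1 + (\<Sum>l\<in>eigenvalues K - {1}. a l * l ^ r)"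
proof -
  obtain c where c: "\<And>l. K *v c l = l *\<^sub>R c l" and dec: "axis y 1 = (\<Sum>l\<in>eigenvalues K. c l)"
    using eigenvector_decomposition[OF fin, of "axis y 1"] reversible_eigenvectors_span[OF rev pos]
    by auto
  have 1: "1 \<in> eigenvalues K" using K by (rule one_in_eigenvalues)
  let ?I = "\<lambda>f :: real^'a. \<Sum>z\<in>UNIV. pmf \<pi> z * f $ z"
  have mean0: "?I (c l) = 0" if "l \<noteq> 1" for l
  proof -
    have "l * ?I (c l) = ?I (K *v c l)" by (simp add: c sum_distrib_left mult_ac)
    thus ?thesis using that by (simp add: stationary[OF K rev])
  qed
  have const: "c 1 $ z = c 1 $ x" for z
    using ergodic_harmonic_constant[OF K erg fin, of "c 1"] c[of 1] by simp
  have "pmf \<pi> y = ?I (axis y 1)" by (simp add: axis_def if_distrib cong: if_cong)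
  also have "\<dots> = (\<Sum>l\<in>eigenvalues K. ?I (c l))"
    unfolding dec by (simp add: sum_distrib_left) (rule sum.swap)
  also have "\<dots> = ?I (c 1)"
    using fin 1 mean0 by (subst sum.remove[of _ 1]) auto
  also have "\<dots> = (\<Sum>z\<in>UNIV. pmf \<pi> z) * c 1 $ x"
    by (subst const) (simp add: sum_distrib_right)
  also have "(\<Sum>z\<in>UNIV. pmf \<pi> z) = 1" by (rule sum_pmf_eq_1) auto
  finally have c1: "c 1 $ x = pmf \<pi> y" by simp
  have "matrix_power K r $ x $ y / pmf \<pi> y
      = 1 + (\<Sum>l\<in>eigenvalues K - {1}. c l $ x / pmf \<pi> y * l ^ r)" for r
  proof -
    have "matrix_power K r $ x $ y = (matrix_power K r *v axis y 1) $ x"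
      by (simp add: matrix_vector_mult_basis column_def)
    also have "\<dots> = (\<Sum>l\<in>eigenvalues K. l ^ r * c l $ x)"
      unfolding dec
      by (simp add: linear_sum[OF matrix_vector_mul_linear] matrix_power_eigenvector[OF c])
    also have "\<dots> = pmf \<pi> y + (\<Sum>l\<in>eigenvalues K - {1}. l ^ r * c l $ x)"
      using fin 1 c1 by (subst sum.remove[of _ 1]) auto
    finally show ?thesis
      using pos[of y] by (simp add: add_divide_distrib sum_divide_distrib mult_ac)
  qed
  thus ?thesis by (rule that)
qed

section \<open>Exponential sums with vanishing initial values\<close>

text \<open>
  The hypothesis says that the functional \<open>p \<mapsto> p(z) + (\<Sum>j\<in>I. a\<^sub>j p(\<mu>\<^sub>j))\<close> kills the monomials, hence
  all polynomials, of degree less than \<open>card I\<close>. Evaluating it at the product of the factors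
  \<open>X - \<mu>\<^sub>j\<close> with \<open>j \<noteq> i\<close> isolates \<open>a\<^sub>i\<close>.
\<close>

lemma exponential_sum_coefficient:
  fixes \<mu> a :: "'i \<Rightarrow> 'b::field"
  assumes fin: "finite I" and inj: "inj_on \<mu> I" and i: "i \<in> I"
    and vanish: "\<And>r. r < card I \<Longrightarrow> z ^ r + (\<Sum>j\<in>I. a j * \<mu> j ^ r) = 0"
  shows "a i = - (\<Prod>j\<in>I - {i}. (z - \<mu> j) / (\<mu> i - \<mu> j))"
proof -
  define p where "p = (\<Prod>j\<in>I - {i}. [:- \<mu> j, 1:])"
  have eval: "poly p t = (\<Prod>j\<in>I - {i}. t - \<mu> j)" for t by (simp add: p_def poly_prod)
  have "degree p \<le> (\<Sum>j\<in>I - {i}. degree [:- \<mu> j, 1:])"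
    unfolding p_def using fin degree_prod_sum_le[of "I - {i}" "\<lambda>j. [:- \<mu> j, 1:]"] by (simp add: o_def)
  also have "\<dots> = card I - 1" using i by simp
  finally have deg: "degree p < card I"
    using fin i by (metis Suc_pred card_gt_0_iff empty_iff le_imp_less_Suc One_nat_def)
  have "poly p z + (\<Sum>j\<in>I. a j * poly p (\<mu> j))
      = (\<Sum>r\<le>degree p. coeff p r * (z ^ r + (\<Sum>j\<in>I. a j * \<mu> j ^ r)))"
    by (simp add: poly_altdef sum_distrib_left distrib_left sum.distrib mult_ac)
       (subst sum.swap, rule refl)
  also have "\<dots> = 0" using vanish deg by (intro sum.neutral) auto
  also have "(\<Sum>j\<in>I. a j * poly p (\<mu> j)) = a i * poly p (\<mu> i)"
  proof -
    have "poly p (\<mu> j) = 0" if "j \<in> I - {i}" for j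
      using fin that by (auto simp: eval prod_zero_iff)
    thus ?thesis using fin i by (simp add: sum.remove[of I i])
  qed
  finally have "a i * poly p (\<mu> i) = - poly p z" by (simp add: eq_neg_iff_add_eq_0 add.commute)
  moreover have "poly p (\<mu> i) \<noteq> 0"
    using fin inj i by (auto simp: eval inj_on_eq_iff)
  ultimately show ?thesis by (simp add: eval prod_dividef field_simps)
qed

section \<open>Transition probabilities between points at distance \<open>d\<close>\<close>

theorem proposition5p1:
  fixes K :: "real^'a^'a" and \<pi> :: "'a pmf" and lam :: "nat \<Rightarrow> real" and d :: nat and x y :: 'a
  assumes "transition_matrix K"
    and "ergodic K"
    and "reversible K \<pi>"
    and "\<And>z. pmf \<pi> z > 0"
    and "inj_on lam {1..d}"
    and "1 \<notin> lam ` {1..d}"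
    and "eigenvalues K = insert 1 (lam ` {1..d})"
    and "chain_dist K x y = enat d"
  shows "\<forall>r::nat. 1 - matrix_power K r $ x $ y / pmf \<pi> y =
    (\<Sum>i = 1..d. lam i ^ r * (\<Prod>j \<in> {1..d} - {i}. (1 - lam j) / (lam i - lam j)))"
proof
  fix r
  have "finite (eigenvalues K)" using assms(7) by simp
  then obtain a where a: "\<And>r. matrix_power K r $ x $ y / pmf \<pi> y
      = 1 + (\<Sum>l\<in>eigenvalues K - {1}. a l * l ^ r)"
    using spectral_expansion[OF assms(1-4), of x y] by metis
  have ev: "eigenvalues K - {1} = lam ` {1..d}" using assms(6,7) by blast
  have expand: "matrix_power K r $ x $ y / pmf \<pi> y = 1 + (\<Sum>i=1..d. a (lam i) * lam i ^ r)" for r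
    unfolding a ev by (simp only: sum.reindex[OF assms(5), unfolded o_def])
  have "1 ^ r + (\<Sum>i=1..d. a (lam i) * lam i ^ r) = 0" if "r < card {1..d}" for r
    using expand[of r] matrix_power_eq_0_if_less_chain_dist[OF assms(1), of r x y] assms(8) that
    by simp
  from exponential_sum_coefficient[OF finite_atLeastAtMost assms(5) _ this]
  have "a (lam i) = - (\<Prod>j\<in>{1..d} - {i}. (1 - lam j) / (lam i - lam j))" if "i \<in> {1..d}" for i
    using that by blast
  thus "1 - matrix_power K r $ x $ y / pmf \<pi> y =
    (\<Sum>i = 1..d. lam i ^ r * (\<Prod>j \<in> {1..d} - {i}. (1 - lam j) / (lam i - lam j)))"
    by (simp add: expand sum_negf mult.commute)
qed

end
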